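(* Let $\underline d=(d_1,d_2)$ with $d=d_1+d_2$, $d_1,d_2\ge1$, and let $\mathscr{C}$ be a cone in $\mathscr{T}^+_{\underline d}$ with finitely many faces. Let $(X,\mu)$ be a probability space and let $f_T$, $T\in\mathscr{C}$, be positive measurable functions on $X$. Suppose that there exist $a,c>0$ and $b\ge0$ such that for every sequence $(\Delta_n)$ of finite subsets of $\mathscr{C}$ satisfying $$|\Delta_n|\to\infty,\qquad\frac{\min_{T\ne T'\in\Delta_n}\max_p|\log T_p-\log T'_p|}{\log|\Delta_n|}\to\infty,\qquad\frac{\min_{T\in\Delta_n}\lfloor T\rfloor_{\underline d}}{\log|\Delta_n|}\to\infty,$$ the minima $\mathfrak{M}_{\Delta_n}:=\min\{f_T:T\in\Delta_n\}$ satisfy $$|\Delta_n|^a(\log|\Delta_n|)^b\cdot\mathfrak{M}_{\Delta_n}\Longrightarrow\mathrm{Wei}(c,a)$$ in distribution with respect to $\mu$ as $n\to\infty$. Then, with $d_0=\dim(\mathscr{C})$, for every $\delta<d_0$ and $\mu$-almost every $x\in X$, $$\liminf_{\|T\|_\infty\to\infty}(\log\|T\|_\infty)^{a\delta}f_T(x)=0,$$ where the liminf is taken over $T\in\mathscr{C}$.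
   Context: $\mathscr{T}^+_{\underline d}$ is the set of $T=(T_1,\ldots,T_d)$ with $T_p>0$, $T_1\cdots T_d=1$, $T_1,\ldots,T_{d_1}\ge1$ and $T_{d_1+1},\ldots,T_d\le1$; it is a multiplicative semigroup. For such $T$, $\lfloor T\rfloor_{\underline d}=\min(\log T_1,\ldots,\log T_{d_1},-\log T_{d_1+1},\ldots,-\log T_d)$ and $\|T\|_\infty=\max_pT_p$. A cone with finitely many faces in $\mathscr{T}^+_{\underline d}$ is a subset whose image under the coordinatewise logarithm is a convex polyhedral cone in $\mathbb{R}^d$; its dimension is the dimension of the linear span of that image. $\mathrm{Wei}(\lambda,a)$ denotes the Weibull distribution with scale $\lambda$ and shape $a$, defined by the distribution function $1-\exp(-(\lambda t)^a)$ for $t\ge0$.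
   Formalization: The formal theorem also assumes that the cone contains some T with ⌊T⌋ > 0; otherwise no admissible sequence (Δ_n) exists and the claim fails, e.g. for d=(2,1), the cone {(1,e^t,e^{-t}) : t≥0}, f_T=1, δ=1/2. *)

theory Defs
  imports "HOL-Probability.Probability" "HOL-Library.Going_To_Filter" "HOL-Real_Asymp.Real_Asymp"
begin

text \<open>
  Vectors with \<open>d = d\<^sub>1 + d\<^sub>2\<close> coordinates are indexed by a sum type \<open>'p + 'q\<close>, where
  \<open>d\<^sub>1 = CARD('p)\<close> and \<open>d\<^sub>2 = CARD('q)\<close>: the index \<open>Inl p\<close> stands for one of the first \<open>d\<^sub>1\<close>
  coordinates, \<open>Inr q\<close> for one of the last \<open>d\<^sub>2\<close>. Since types are nonempty, \<open>d\<^sub>1, d\<^sub>2 \<ge> 1\<close>.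
\<close>

definition T_plus :: "(real ^ ('p::finite + 'q::finite)) set" where
  "T_plus = {T. (\<forall>i. T $ i > 0) \<and> (\<Prod>i\<in>UNIV. T $ i) = 1 \<and>
                (\<forall>p. T $ Inl p \<ge> 1) \<and> (\<forall>q. T $ Inr q \<le> 1)}"

definition T_floor :: "real ^ ('p::finite + 'q::finite) \<Rightarrow> real" where
  "T_floor T = Min (range (\<lambda>p. ln (T $ Inl p)) \<union> range (\<lambda>q. - ln (T $ Inr q)))"

text \<open>
  \<open>T_floor T \<ge> 0\<close> on \<open>T_plus\<close>, with equality iff some coordinate of \<open>T\<close> equals 1. On a cone where
  it vanishes identically no sequence of finite subsets satisfies
  \<open>Min (T_floor ` \<Delta> n) / ln (card (\<Delta> n)) \<longrightarrow> \<infinity>\<close>, so any assumption about all such sequences is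
  vacuous there; the theorem therefore requires a point of the cone with \<open>T_floor T > 0\<close>.
\<close>

definition T_max :: "real ^ 'n::finite \<Rightarrow> real" where
  "T_max T = Max (range (\<lambda>i. T $ i))"

definition log_vec :: "real ^ 'n::finite \<Rightarrow> real ^ 'n" where
  "log_vec T = (\<chi> i. ln (T $ i))"

definition polyhedral_cone_in_T_plus :: "(real ^ ('p::finite + 'q::finite)) set \<Rightarrow> bool" where
  "polyhedral_cone_in_T_plus C \<longleftrightarrow>
     C \<subseteq> T_plus \<and> convex_cone (log_vec ` C) \<and> polyhedron (log_vec ` C)"

text \<open>The library function \<^const>\<open>dim\<close> of a set is the dimension of its linear span.\<close>

definition cone_dim :: "(real ^ 'n::finite) set \<Rightarrow> nat" where
  "cone_dim C = dim (log_vec ` C)"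

definition log_dist :: "real ^ 'n::finite \<Rightarrow> real ^ 'n \<Rightarrow> real" where
  "log_dist T T' = Max (range (\<lambda>i. \<bar>ln (T $ i) - ln (T' $ i)\<bar>))"

text \<open>Only meaningful for finite sets with at least two elements.\<close>

definition log_sep :: "(real ^ 'n::finite) set \<Rightarrow> real" where
  "log_sep D = Min {log_dist T T' | T T'. T \<in> D \<and> T' \<in> D \<and> T \<noteq> T'}"

definition weibull_cdf :: "real \<Rightarrow> real \<Rightarrow> real \<Rightarrow> real" where
  "weibull_cdf l a t = (if t < 0 then 0 else 1 - exp (- ((l * t) powr a)))"

definition weibull :: "real \<Rightarrow> real \<Rightarrow> real measure" where
  "weibull l a = interval_measure (weibull_cdf l a)"

lemma
  assumes "l > 0" "a > 0"
  shows real_distribution_weibull: "real_distribution (weibull l a)"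
    and cdf_weibull: "cdf (weibull l a) = weibull_cdf l a"
proof -
  let ?F = "weibull_cdf l a"
  have mono: "?F x \<le> ?F y" if "x \<le> y" for x y
    using that assms by (auto simp: weibull_cdf_def intro!: powr_mono2)
  have cont: "continuous (at_right x) ?F" for x
  proof (cases "x < 0")
    case True
    have "eventually (\<lambda>t. t < 0) (at_right x)"
      using True by (auto simp: eventually_at_right[of x 0])
    then have "eventually (\<lambda>t. 0 = ?F t) (at_right x)"
      by eventually_elim (simp add: weibull_cdf_def)
    then have "(?F \<longlongrightarrow> 0) (at_right x)"
      by (rule Lim_transform_eventually[OF tendsto_const])
    with True show ?thesis by (simp add: continuous_within weibull_cdf_def)
  next
    case False
    have "((\<lambda>t. l * t) \<longlongrightarrow> l * x) (at_right x)"
      by (intro tendsto_intros)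
    moreover have nn: "eventually (\<lambda>t. 0 \<le> l * t) (at_right x)"
      using False assms by (auto simp: eventually_at_filter intro!: always_eventually)
    ultimately have "((\<lambda>t. (l * t) powr a) \<longlongrightarrow> (l * x) powr a) (at_right x)"
      using assms by (intro tendsto_powr2 tendsto_const) auto
    then have "((\<lambda>t. 1 - exp (- ((l * t) powr a))) \<longlongrightarrow> ?F x) (at_right x)"
      using False unfolding weibull_cdf_def by (auto intro!: tendsto_intros)
    moreover have "eventually (\<lambda>t. 1 - exp (- ((l * t) powr a)) = ?F t) (at_right x)"
      using False by (auto simp: eventually_at_filter weibull_cdf_def intro!: always_eventually)
    ultimately have "(?F \<longlongrightarrow> ?F x) (at_right x)"
      by (rule Lim_transform_eventually)
    then show ?thesis by (simp add: continuous_within)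
  qed
  have "eventually (\<lambda>t. 0 = ?F t) at_bot"
    using eventually_gt_at_bot[of 0] by eventually_elim (simp add: weibull_cdf_def)
  then have bot: "(?F \<longlongrightarrow> 0) at_bot"
    by (rule Lim_transform_eventually[OF tendsto_const])
  have "((\<lambda>t. 1 - exp (- ((l * t) powr a))) \<longlongrightarrow> 1) at_top"
    using assms by real_asymp
  moreover have "eventually (\<lambda>t. 1 - exp (- ((l * t) powr a)) = ?F t) at_top"
    using eventually_ge_at_top[of 0] by eventually_elim (simp add: weibull_cdf_def)
  ultimately have top: "(?F \<longlongrightarrow> 1) at_top"
    by (rule Lim_transform_eventually)
  show "real_distribution (weibull l a)"
    unfolding weibull_def by (rule real_distribution_interval_measure) (fact mono cont bot top)+
  show "cdf (weibull l a) = weibull_cdf l a"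
    unfolding weibull_def by (rule cdf_interval_measure) (fact mono cont bot)+
qed

end

theory Submission
  imports Defs
begin

text \<open>
  In logarithmic coordinates \<open>C\<close> is a convex cone containing a vector \<open>u\<close> with positive floor
  together with \<open>d\<^sub>0\<close> linearly independent vectors. Spreading out the box of side \<open>m\<close> in the
  semigroup they generate, shifted by \<open>m u\<close>, by a factor \<open>s = m\<^sup>\<epsilon>\<close> yields \<open>m ^ d\<^sub>0\<close> points
  with separation of order \<open>m\<^sup>\<epsilon>\<close> and with floor and norm of order \<open>m\<^bsup>1 + \<epsilon>\<^esup>\<close>. The hypothesis
  applies to these sets. When \<open>(1 + \<epsilon>) \<delta> < d\<^sub>0\<close>, the minima multiplied by
  \<open>m\<^bsup>(1 + \<epsilon>) a \<delta>\<^esup>\<close> are a null sequence times a tight one, so they tend to \<open>0\<close> in probability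
  and are almost surely arbitrarily small for infinitely many \<open>m\<close>.
\<close>

section \<open>Vanishing multiples of a weakly convergent sequence\<close>

text \<open>Weak convergence to a probability law makes \<open>X\<close> tight, so
  \<open>\<gamma> n * X n\<close> can exceed \<open>\<eta>\<close> only with probability tending to
  0. Exceeding \<open>\<eta>\<close> for all n from some N on is an event inside each of these,
  hence null, and there are only countably many N.\<close>

lemma (in prob_space) frequently_scaled_le_of_weak_conv:
  fixes X :: "nat \<Rightarrow> 'a \<Rightarrow> real" and \<gamma> :: "nat \<Rightarrow> real"
  assumes rv: "\<And>n. random_variable borel (X n)"
    and \<mu>: "real_distribution \<mu>"
    and conv: "weak_conv_m (\<lambda>n. distr M borel (X n)) \<mu>"
    and \<gamma>: "\<gamma> \<longlonglongrightarrow> 0" and \<gamma>_pos: "\<And>n. \<gamma> n > 0" and \<eta>: "\<eta> > 0"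
  shows "AE x in M. \<exists>\<^sub>F n in sequentially. \<gamma> n * X n x \<le> \<eta>"
proof -
  interpret \<mu>: real_distribution \<mu> by (fact \<mu>)
  note [measurable] = rv
  define A where "A n = {x \<in> space M. \<eta> < \<gamma> n * X n x}" for n
  have [measurable]: "A n \<in> events" for n
    unfolding A_def by measurable
  have lim: "(\<lambda>n. prob (A n)) \<longlonglongrightarrow> 0"
  proof (rule order_tendstoI)
    show "\<forall>\<^sub>F n in sequentially. prob (A n) > y" if "y < 0" for y
      using that by (intro always_eventually allI less_le_trans[OF that measure_nonneg])
  next
    fix r :: real assume r: "0 < r"
    have "\<forall>\<^sub>F t in at_top. cdf \<mu> t > 1 - r"
      using r by (intro order_tendstoD(1)[OF \<mu>.cdf_lim_at_top_prob]) simp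
    then obtain t0 where t0: "\<And>t. t \<ge> t0 \<Longrightarrow> cdf \<mu> t > 1 - r"
      unfolding eventually_at_top_linorder by blast
    have "mono (cdf \<mu>)"
      by (intro monoI \<mu>.cdf_nondecreasing)
    \<comment> \<open>A monotone function has countably many discontinuities, so a continuity point
      exists beyond any bound; weak convergence gives the cdf limit only at such points. Taking t
      above 1 makes \<open>\<eta> / t\<close> a positive threshold.\<close>
    then obtain t where t: "t > max t0 1" "isCont (cdf \<mu>) t"
      using open_minus_countable[OF mono_ctble_discont, of "cdf \<mu>" "{max t0 1<..}"] by auto
    have "(\<lambda>n. cdf (distr M borel (X n)) t) \<longlonglongrightarrow> cdf \<mu> t"
      using conv t(2) by (simp add: weak_conv_m_def weak_conv_def)
    then have ev1: "\<forall>\<^sub>F n in sequentially. cdf (distr M borel (X n)) t > 1 - r"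
      using t0[of t] t(1) by (intro order_tendstoD(1)) auto
    have ev2: "\<forall>\<^sub>F n in sequentially. \<gamma> n < \<eta> / t"
      using \<eta> t(1) by (intro order_tendstoD(2)[OF \<gamma>]) auto
    show "\<forall>\<^sub>F n in sequentially. prob (A n) < r"
      using ev1 ev2
    proof eventually_elim
      case (elim n)
      have "A n \<subseteq> space M - {x \<in> space M. X n x \<le> t}"
      proof -
        \<comment> \<open>Since \<open>\<gamma> n < \<eta> / t\<close>, the scaled value can exceed
          \<open>\<eta>\<close> only if \<open>X n x\<close> exceeds t, so \<open>A n\<close> lies
          in the upper tail of \<open>X n\<close>.\<close>
        have "t < X n x" if "\<eta> < \<gamma> n * X n x" for x
        proof (rule ccontr)
          assume "\<not> t < X n x"
          then have "\<gamma> n * X n x \<le> \<gamma> n * t"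
            using \<gamma>_pos[of n] by (intro mult_left_mono) auto
          also have "\<dots> < \<eta>"
            using elim(2) t(1) by (simp add: field_simps)
          finally show False using that by simp
        qed
        then show ?thesis unfolding A_def by force
      qed
      then have "prob (A n) \<le> prob (space M - {x \<in> space M. X n x \<le> t})"
        by (intro finite_measure_mono) auto
      also have "\<dots> = 1 - prob {x \<in> space M. X n x \<le> t}"
        by (intro prob_compl) measurable
      also have "{x \<in> space M. X n x \<le> t} = X n -` {..t} \<inter> space M"
        by auto
      also have "prob \<dots> = cdf (distr M borel (X n)) t"
        by (simp add: cdf_def measure_distr)
      finally show ?case using elim(1) by simp
    qed
  qed
  have "AE x in M. \<not> (\<forall>n\<ge>N. x \<in> A n)" for N
  proof -
    define B where "B = {x \<in> space M. \<forall>n\<ge>N. x \<in> A n}"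
    have [measurable]: "B \<in> events"
      unfolding B_def by measurable
    \<comment> \<open>B is contained in \<open>A n\<close> for every n from N on, so its probability
      is at most the limit 0.\<close>
    have "\<forall>\<^sub>F n in sequentially. prob B \<le> prob (A n)"
      using eventually_ge_at_top[of N]
      by eventually_elim (auto simp: B_def intro!: finite_measure_mono)
    then have "prob B \<le> 0"
      using lim by (intro tendsto_lowerbound[OF lim]) auto
    then have "B \<in> null_sets M"
      using measure_nonneg[of M B]
      by (intro null_setsI) (auto simp: emeasure_eq_measure)
    from AE_not_in[OF this] show ?thesis
      by (auto simp: B_def)
  qed
  then have "AE x in M. \<forall>N. \<not> (\<forall>n\<ge>N. x \<in> A n)"
    by (simp add: AE_all_countable)
  with AE_space show ?thesis
    by eventually_elim (auto simp: A_def frequently_def eventually_sequentially not_le)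
qed

section \<open>Separation of integer combinations of independent vectors\<close>

text \<open>The coordinate functionals \<open>g b\<close> of the independent set are bounded, and
  two natural coefficients that differ do so by at least 1. Hence the vectors differ by at least the
  inverse of a common bound on these functionals.\<close>

lemma independent_separated_lattice:
  fixes B :: "'b::euclidean_space set"
  assumes "finite B" "independent B"
  obtains \<kappa> where "\<kappa> > 0"
    "\<And>k k' :: 'b \<Rightarrow> nat. \<exists>b\<in>B. k b \<noteq> k' b \<Longrightarrow>
       \<kappa> \<le> norm ((\<Sum>b\<in>B. real (k b) *\<^sub>R b) - (\<Sum>b\<in>B. real (k' b) *\<^sub>R b))"
proof -
  have "\<exists>g :: 'b \<Rightarrow> real. linear g \<and> (\<forall>x\<in>B. g x = (if x = b then 1 else 0))" for b
    by (rule linear_independent_extend[OF assms(2)])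
  then have "\<exists>g. \<forall>b. linear (g b) \<and> (\<forall>x\<in>B. g b x = (if x = b then 1 else (0::real)))"
    by (intro choice allI)
  then obtain g :: "'b \<Rightarrow> 'b \<Rightarrow> real" where
    "\<forall>b. linear (g b) \<and> (\<forall>x\<in>B. g b x = (if x = b then 1 else 0))"
    by (rule exE)
  then have lin: "linear (g b)" and g: "x \<in> B \<Longrightarrow> g b x = (if x = b then 1 else 0)" for b x
    by blast+
  have "\<exists>K>0. \<forall>x. norm (g b x) \<le> K * norm x" for b
    by (rule linear_bounded_pos[OF lin[of b]]) (intro exI conjI allI)
  then have "\<exists>K. \<forall>b. K b > 0 \<and> (\<forall>x. norm (g b x) \<le> K b * norm x)"
    by (intro choice allI)
  then obtain K where "\<forall>b. K b > 0 \<and> (\<forall>x. norm (g b x) \<le> K b * norm x)"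
    by (rule exE)
  then have K: "K b > 0" "norm (g b x) \<le> K b * norm x" for b x
    by blast+
  \<comment> \<open>The sum dominates every \<open>K b\<close> at once, making the bound uniform in
    b; the summand 1 keeps R positive for empty B.\<close>
  define R where "R = 1 + (\<Sum>b\<in>B. K b)"
  have R: "R > 0"
    unfolding R_def using K(1) by (intro add_pos_nonneg sum_nonneg) (auto simp: less_imp_le)
  have "1 / R \<le> norm ((\<Sum>b\<in>B. real (k b) *\<^sub>R b) - (\<Sum>b\<in>B. real (k' b) *\<^sub>R b))"
    if "\<exists>b\<in>B. k b \<noteq> k' b" for k k' :: "'b \<Rightarrow> nat"
  proof -
    from that obtain b where b: "b \<in> B" "k b \<noteq> k' b" by blast
    let ?v = "\<lambda>k :: 'b \<Rightarrow> nat. \<Sum>b\<in>B. real (k b) *\<^sub>R b"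
    have coord: "g b (?v k) = real (k b)" for k
    proof -
      have "g b (?v k) = (\<Sum>x\<in>B. real (k x) * g b x)"
        by (simp add: linear_sum[OF lin] linear_scale[OF lin])
      also have "\<dots> = (\<Sum>x\<in>B. if x = b then real (k x) else 0)"
        by (intro sum.cong) (auto simp: g)
      finally show ?thesis using b assms(1) by simp
    qed
    have "K b \<le> R"
      unfolding R_def using member_le_sum[OF b(1), of K] K(1) assms(1) by (simp add: less_imp_le)
    have "1 \<le> \<bar>real (k b) - real (k' b)\<bar>"
      using b(2) by linarith
    also have "\<dots> = norm (g b (?v k - ?v k'))"
      by (simp add: linear_diff[OF lin] coord)
    also have "\<dots> \<le> K b * norm (?v k - ?v k')"
      by (rule K)
    also have "\<dots> \<le> R * norm (?v k - ?v k')"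
      using \<open>K b \<le> R\<close> by (intro mult_right_mono) auto
    finally show ?thesis
      using R by (simp add: field_simps)
  qed
  with R show ?thesis by (intro that[of "1 / R"]) auto
qed

section \<open>Floor, maximum and separation in logarithmic coordinates\<close>

lemma T_floor_le_Inl: "T_floor T \<le> ln (T $ Inl p)"
  unfolding T_floor_def by (intro Min_le) auto

lemma T_floor_le_Inr: "T_floor T \<le> - ln (T $ Inr q)"
  unfolding T_floor_def by (intro Min_le) auto

lemma T_floor_ge:
  assumes "\<And>p. r \<le> ln (T $ Inl p)" "\<And>q. r \<le> - ln (T $ Inr q)"
  shows "r \<le> T_floor T"
  unfolding T_floor_def using assms by (subst Min_ge_iff) auto

lemma component_le_T_max: "T $ i \<le> T_max T"
  unfolding T_max_def by (intro Max_ge) auto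

lemma T_max_attained: obtains i where "T_max T = T $ i"
proof -
  have "T_max T \<in> range (\<lambda>i. T $ i)"
    unfolding T_max_def by (intro Max_in) auto
  then show ?thesis using that by auto
qed

lemma T_floor_le_ln_T_max:
  assumes "\<And>i. T $ i > 0"
  shows "T_floor T \<le> ln (T_max T)"
proof -
  \<comment> \<open>Any one of the first coordinates, present since the index type is nonempty, lies
    between the floor and the maximum.\<close>
  fix p
  have "T_floor T \<le> ln (T $ Inl p)" by (rule T_floor_le_Inl)
  also have "\<dots> \<le> ln (T_max T)"
    using assms component_le_T_max[of T "Inl p"] by (intro ln_mono) auto
  finally show ?thesis .
qed

lemma ln_T_max_le_norm: "ln (T_max T) \<le> norm (log_vec T)"
proof -
  obtain i where "T_max T = T $ i" by (rule T_max_attained)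
  then show ?thesis
    using component_le_norm_cart[of "log_vec T" i] by (simp add: log_vec_def)
qed

text \<open>Euclidean separation of the lattice thereby transfers to \<open>log_dist\<close>, a
  maximum over coordinates; the factor comes from passing through the l1 norm.\<close>

lemma norm_log_vec_diff_le:
  "norm (log_vec T - log_vec T') \<le> real CARD('n) * log_dist T (T' :: real ^ 'n::finite)"
proof -
  have "norm (log_vec T - log_vec T') \<le> (\<Sum>i\<in>UNIV. \<bar>(log_vec T - log_vec T') $ i\<bar>)"
    by (rule norm_le_l1_cart)
  also have "\<dots> \<le> (\<Sum>i\<in>(UNIV :: 'n set). log_dist T T')"
    by (intro sum_mono) (auto simp: log_dist_def log_vec_def intro!: Max_ge)
  finally show ?thesis by simp
qed

text \<open>Two distinct points make the set of distances nonempty, so that its \<open>Min\<close>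
  is attained.\<close>

lemma log_sep_ge:
  assumes "finite D" "card D \<ge> 2"
    and "\<And>T T'. T \<in> D \<Longrightarrow> T' \<in> D \<Longrightarrow> T \<noteq> T' \<Longrightarrow> r \<le> log_dist T T'"
  shows "r \<le> log_sep D"
proof -
  let ?S = "{log_dist T T' | T T'. T \<in> D \<and> T' \<in> D \<and> T \<noteq> T'}"
  have "?S \<subseteq> (\<lambda>(T, T'). log_dist T T') ` (D \<times> D)"
    by auto
  then have "finite ?S"
    using assms(1) by (meson finite_SigmaI finite_imageI finite_subset)
  moreover have "\<exists>T\<in>D. \<exists>T'\<in>D. T \<noteq> T'"
    using assms(2) card_le_Suc0_iff_eq[OF assms(1)] by fastforce
  then have "?S \<noteq> {}" by blast
  ultimately show ?thesis
    unfolding log_sep_def using assms(3) by (subst Min_ge_iff) auto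
qed

section \<open>Finite grids in the cone\<close>

text \<open>The constants are chosen before m and s. The size m alone governs the number of points
  and the dilation s alone the separation, while floor and norm scale with their product; this
  leaves the growth of s free.\<close>

lemma cone_grids:
  fixes C :: "(real ^ ('p::finite + 'q::finite)) set"
  assumes cone: "polyhedral_cone_in_T_plus C"
    and nondegenerate: "\<exists>T\<in>C. T_floor T > 0"
  obtains \<kappa> \<tau> K where "\<kappa> > 0" "\<tau> > 0" "K > 0" "cone_dim C \<ge> 1"
    "\<And>(m::nat) (s::real). m \<ge> 2 \<Longrightarrow> s > 0 \<Longrightarrow>
       \<exists>D. finite D \<and> D \<subseteq> C \<and> card D = m ^ cone_dim C \<and> \<kappa> * s \<le> log_sep D \<and>
           (\<forall>T\<in>D. \<tau> * (m * s) \<le> T_floor T \<and> ln (T_max T) \<le> K * (m * s))"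
proof -
  define L where "L = log_vec ` C"
  have CT: "C \<subseteq> T_plus" and L: "convex_cone L"
    using cone by (auto simp: polyhedral_cone_in_T_plus_def L_def)
  have pos: "T $ i > 0" if "T \<in> C" for T i
    using that CT by (auto simp: T_plus_def)
  have L_Inl: "v $ Inl p \<ge> 0" and L_Inr: "v $ Inr q \<le> 0" if "v \<in> L" for v p q
    using that CT pos by (auto simp: L_def log_vec_def T_plus_def)
  \<comment> \<open>The coordinatewise exponential inverts \<open>log_vec\<close> on C, so points
    built in L can be carried back to C.\<close>
  define E :: "real ^ ('p + 'q) \<Rightarrow> real ^ ('p + 'q)" where "E v = (\<chi> i. exp (v $ i))" for v
  have log_E: "log_vec (E v) = v" for v
    by (simp add: log_vec_def E_def)
  have ln_E: "ln (E v $ i) = v $ i" for v i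
    by (simp add: E_def)
  have E_C: "E v \<in> C" if "v \<in> L" for v
  proof -
    from that obtain T where T: "T \<in> C" "v = log_vec T" by (auto simp: L_def)
    then have "E v = T"
      using pos by (simp add: E_def log_vec_def vec_eq_iff)
    with T show ?thesis by simp
  qed
  obtain T0 where T0: "T0 \<in> C" "T_floor T0 > 0" using nondegenerate by blast
  define u where "u = log_vec T0"
  define \<tau> where "\<tau> = T_floor T0"
  have u: "u \<in> L" using T0 by (auto simp: u_def L_def)
  have u_Inl: "\<tau> \<le> u $ Inl p" and u_Inr: "\<tau> \<le> - (u $ Inr q)" for p q
    using T_floor_le_Inl[of T0 p] T_floor_le_Inr[of T0 q] by (simp_all add: \<tau>_def u_def log_vec_def)
  have "u \<noteq> 0" using u_Inl T0(2) by (force simp: \<tau>_def)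
  \<comment> \<open>The basis is taken inside L itself, so nonnegative combinations of it stay in
    the cone.\<close>
  obtain B where B: "B \<subseteq> L" "independent B" "L \<subseteq> span B" "card B = dim L"
    by (rule basis_exists)
  have dim: "card B = cone_dim C" using B(4) by (simp add: cone_dim_def L_def)
  have finB: "finite B" using B(2) by (rule independent_imp_finite)
  have "B \<noteq> {}" using B(3) u \<open>u \<noteq> 0\<close> by auto
  then have dim1: "cone_dim C \<ge> 1" using finB dim by (metis One_nat_def Suc_leI card_gt_0_iff)
  obtain \<kappa> where \<kappa>: "\<kappa> > 0"
    "\<And>k k' :: real ^ ('p + 'q) \<Rightarrow> nat. \<exists>b\<in>B. k b \<noteq> k' b \<Longrightarrow>
       \<kappa> \<le> norm ((\<Sum>b\<in>B. real (k b) *\<^sub>R b) - (\<Sum>b\<in>B. real (k' b) *\<^sub>R b))"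
    using independent_separated_lattice[OF finB B(2)] by blast
  \<comment> \<open>With coefficients below m, the norm of \<open>real m *\<^sub>R u + w k\<close>
    is at most K m; the summand 1 keeps K positive.\<close>
  define K where "K = 1 + norm u + (\<Sum>b\<in>B. norm b)"
  have K: "K > 0" unfolding K_def by (intro add_pos_nonneg sum_nonneg) auto
  define N where "N = real CARD('p + 'q)"
  have N: "N > 0" unfolding N_def of_nat_0_less_iff by (rule zero_less_card_finite)
  have "\<exists>D. finite D \<and> D \<subseteq> C \<and> card D = m ^ cone_dim C \<and> \<kappa> / N * s \<le> log_sep D \<and>
           (\<forall>T\<in>D. \<tau> * (m * s) \<le> T_floor T \<and> ln (T_max T) \<le> K * (m * s))"
    if m: "m \<ge> 2" and s: "s > 0" for m :: nat and s :: real
  proof -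
    define w where "w k = (\<Sum>b\<in>B. real (k b) *\<^sub>R b)" for k :: "real ^ ('p + 'q) \<Rightarrow> nat"
    \<comment> \<open>The shift by m u forces the floor to grow linearly in m even where
      \<open>w k\<close> lies on the boundary of the cone; the factor s then spreads the points
      apart.\<close>
    define v where "v k = s *\<^sub>R (real m *\<^sub>R u + w k)" for k
    \<comment> \<open>Extensional functions: distinct members differ somewhere on B, and there are
      exactly m to the power \<open>card B\<close> of them.\<close>
    define P where "P = (B \<rightarrow>\<^sub>E {..<m})"
    define D where "D = (E \<circ> v) ` P"
    have finP: "finite P" unfolding P_def using finB by (intro finite_PiE) auto
    have w_L: "w k \<in> L" for k
    proof -
      have "(\<Sum>b\<in>A. real (k b) *\<^sub>R b) \<in> L" if "A \<subseteq> B" for A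
        using finite_subset[OF that finB] that
      proof induction
        case empty
        then show ?case using L by (simp add: convex_cone_contains_0)
      next
        case (insert x F)
        then have "real (k x) *\<^sub>R x \<in> L"
          using B(1) by (intro convex_cone_scaleR[OF L]) auto
        with insert show ?case by (simp add: convex_cone_add[OF L])
      qed
      then show ?thesis by (simp add: w_def)
    qed
    have v_L: "v k \<in> L" for k
      unfolding v_def using u w_L s by (intro convex_cone_scaleR[OF L] convex_cone_add[OF L]) auto
    have sep: "\<kappa> * s \<le> norm (v k - v k')" if k: "k \<in> P" "k' \<in> P" "k \<noteq> k'" for k k'
    proof -
      have "\<exists>b\<in>B. k b \<noteq> k' b"
        using PiE_ext[of k B "\<lambda>_. {..<m}" k'] k unfolding P_def by blast
      then have "\<kappa> \<le> norm (w k - w k')"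
        unfolding w_def by (rule \<kappa>(2))
      \<comment> \<open>The common shift cancels in the difference.\<close>
      moreover have "v k - v k' = s *\<^sub>R (w k - w k')"
        by (simp add: v_def algebra_simps)
      ultimately show ?thesis using s by (simp add: mult.commute)
    qed
    have ne: "E (v k) \<noteq> E (v k')" if "k \<in> P" "k' \<in> P" "k \<noteq> k'" for k k'
    proof
      assume "E (v k) = E (v k')"
      then have "v k = v k'" by (metis log_E)
      with sep[OF that] mult_pos_pos[OF \<kappa>(1) s] show False by simp
    qed
    then have "inj_on (E \<circ> v) P" unfolding inj_on_def comp_def by blast
    then have "card D = card P" unfolding D_def by (rule card_image)
    also have "\<dots> = m ^ cone_dim C"
      unfolding P_def using finB dim by (simp add: card_PiE)
    finally have cardD: "card D = m ^ cone_dim C" .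
    have "m ^ 1 \<le> m ^ cone_dim C" using m dim1 by (intro power_increasing) auto
    with m cardD have card2: "card D \<ge> 2" by simp
    have finD: "finite D" using finP by (simp add: D_def)
    have "\<kappa> / N * s \<le> log_sep D"
    proof (rule log_sep_ge[OF finD card2])
      fix T T' assume "T \<in> D" "T' \<in> D" "T \<noteq> T'"
      then obtain k k' where k: "k \<in> P" "k' \<in> P" "k \<noteq> k'" "T = E (v k)" "T' = E (v k')"
        by (auto simp: D_def)
      from sep[OF k(1-3)] norm_log_vec_diff_le[of T T']
      have "\<kappa> * s \<le> N * log_dist T T'" by (simp add: k log_E N_def)
      then show "\<kappa> / N * s \<le> log_dist T T'" using N by (simp add: field_simps)
    qed
    moreover have "\<tau> * (m * s) \<le> T_floor (E (v k))" for k
    proof (rule T_floor_ge)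
      fix p
      \<comment> \<open>Vectors of L are nonnegative in the first block and nonpositive in the
        second, so adding \<open>w k\<close> cannot lower the floor obtained from m u.\<close>
      have "real m * \<tau> \<le> real m * u $ Inl p + w k $ Inl p"
        using L_Inl[OF w_L] mult_left_mono[OF u_Inl[of p], of "real m"] by (simp add: add_increasing2)
      then have "s * (real m * \<tau>) \<le> s * (real m * u $ Inl p + w k $ Inl p)"
        using s by (intro mult_left_mono) auto
      also have "\<dots> = ln (E (v k) $ Inl p)"
        by (simp add: ln_E v_def)
      finally show "\<tau> * (m * s) \<le> ln (E (v k) $ Inl p)"
        by (simp only: mult_ac)
    next
      fix q
      have "real m * \<tau> \<le> - (real m * u $ Inr q + w k $ Inr q)"
        using L_Inr[OF w_L, of k q] mult_left_mono[OF u_Inr[of q], of "real m"] by simp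
      then have "s * (real m * \<tau>) \<le> s * (- (real m * u $ Inr q + w k $ Inr q))"
        using s by (intro mult_left_mono) auto
      also have "\<dots> = - ln (E (v k) $ Inr q)"
        by (simp add: ln_E v_def algebra_simps)
      finally show "\<tau> * (m * s) \<le> - ln (E (v k) $ Inr q)"
        by (simp only: mult_ac)
    qed
    moreover have "ln (T_max (E (v k))) \<le> K * (m * s)" if k: "k \<in> P" for k
    proof -
      have "norm (w k) \<le> (\<Sum>b\<in>B. norm (real (k b) *\<^sub>R b))"
        unfolding w_def by (rule norm_sum)
      also have "\<dots> \<le> (\<Sum>b\<in>B. real m * norm b)"
        using k by (intro sum_mono) (auto simp: P_def PiE_iff less_imp_le intro!: mult_right_mono)
      finally have w: "norm (w k) \<le> real m * (\<Sum>b\<in>B. norm b)"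
        by (simp add: sum_distrib_left)
      have "norm (real m *\<^sub>R u + w k) \<le> real m * norm u + norm (w k)"
        by (rule norm_triangle_le) simp
      also have "\<dots> \<le> K * m"
        using w by (simp add: K_def algebra_simps)
      finally have "norm (v k) \<le> s * (K * m)"
        unfolding v_def using s by (simp add: mult_left_mono)
      then show ?thesis
        using ln_T_max_le_norm[of "E (v k)"] by (simp add: log_E mult_ac)
    qed
    moreover have "D \<subseteq> C" using E_C v_L by (auto simp: D_def)
    ultimately show ?thesis using finD cardD
      by (intro exI[of _ D] conjI ballI) (auto simp: D_def)
  qed
  moreover have "\<kappa> / N > 0" "\<tau> > 0" using \<kappa>(1) N T0(2) by (auto simp: \<tau>_def)
  ultimately show ?thesis using K dim1 by (intro that[of "\<kappa> / N" \<tau> K]) auto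
qed

section \<open>Almost sure smallness along the grids\<close>

theorem propositionA2:
  fixes C :: "(real ^ ('p::finite + 'q::finite)) set"
    and M :: "'a measure"
    and f :: "real ^ ('p + 'q) \<Rightarrow> 'a \<Rightarrow> real"
    and a b c :: real
  assumes cone: "polyhedral_cone_in_T_plus C"
    and nondegenerate: "\<exists>T\<in>C. T_floor T > 0"
    and prob: "prob_space M"
    and measurable: "\<And>T. T \<in> C \<Longrightarrow> f T \<in> borel_measurable M"
    and positive: "\<And>T x. T \<in> C \<Longrightarrow> x \<in> space M \<Longrightarrow> f T x > 0"
    and "a > 0" and "c > 0" and "b \<ge> 0"
    and conv: "\<And>\<Delta> :: nat \<Rightarrow> (real ^ ('p + 'q)) set.
      \<lbrakk>\<And>n. finite (\<Delta> n);
       \<And>n. \<Delta> n \<subseteq> C;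
       filterlim (\<lambda>n. card (\<Delta> n)) at_top sequentially;
       filterlim (\<lambda>n. log_sep (\<Delta> n) / ln (real (card (\<Delta> n)))) at_top sequentially;
       filterlim (\<lambda>n. Min (T_floor ` \<Delta> n) / ln (real (card (\<Delta> n)))) at_top sequentially\<rbrakk>
      \<Longrightarrow> weak_conv_m
            (\<lambda>n. distr M borel (\<lambda>x. real (card (\<Delta> n)) powr a * ln (real (card (\<Delta> n))) powr b
                                     * Min ((\<lambda>T. f T x) ` \<Delta> n)))
            (weibull c a)"
  shows "\<forall>\<delta> < real (cone_dim C). AE x in M.
           Liminf (T_max going_to at_top within C)
             (\<lambda>T. ereal (ln (T_max T) powr (a * \<delta>) * f T x)) = 0"
proof (intro allI impI)
  fix \<delta> assume \<delta>: "\<delta> < real (cone_dim C)"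
  interpret prob_space M by (fact prob)
  obtain \<kappa> \<tau> K where \<kappa>: "\<kappa> > 0" and \<tau>: "\<tau> > 0" and K: "K > 0" and dim1: "cone_dim C \<ge> 1"
    and grid: "\<And>(m::nat) (s::real). m \<ge> 2 \<Longrightarrow> s > 0 \<Longrightarrow>
       \<exists>D. finite D \<and> D \<subseteq> C \<and> card D = m ^ cone_dim C \<and> \<kappa> * s \<le> log_sep D \<and>
           (\<forall>T\<in>D. \<tau> * (m * s) \<le> T_floor T \<and> ln (T_max T) \<le> K * (m * s))"
    using cone_grids[OF cone nondegenerate] by metis
  define d where "d = cone_dim C"
  have d: "d \<ge> 1" "d > 0" using dim1 by (auto simp: d_def)
  \<comment> \<open>A nonnegative exponent makes the power monotone in its base; a negative
    \<open>\<delta>\<close> is covered by 0, the logarithms in question being at least 1.\<close>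
  define \<delta>' where "\<delta>' = max \<delta> 0"
  have \<delta>': "\<delta>' \<ge> 0" "\<delta> \<le> \<delta>'" "\<delta>' < d" using \<delta> d by (auto simp: \<delta>'_def d_def)
  \<comment> \<open>Chosen so that \<open>\<epsilon> * (\<delta>' + 1)\<close> equals
    \<open>d - \<delta>'\<close>, whence \<open>(1 + \<epsilon>) * \<delta>' < d\<close>.\<close>
  define \<epsilon> where "\<epsilon> = (d - \<delta>') / (\<delta>' + 1)"
  have \<epsilon>: "\<epsilon> > 0" using \<delta>' by (simp add: \<epsilon>_def)
  have "\<epsilon> * \<delta>' < \<epsilon> * (\<delta>' + 1)" using \<epsilon> by (intro mult_strict_left_mono) auto
  also have "\<dots> = d - \<delta>'" using \<delta>' by (simp add: \<epsilon>_def)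
  finally have gap: "(1 + \<epsilon>) * \<delta>' < d" by (simp add: algebra_simps)
  \<comment> \<open>The offset 2 meets the size requirement of the grids and makes every
    \<open>ln (card (\<Delta> n))\<close> positive.\<close>
  define m where "m n = n + 2" for n :: nat
  define s where "s n = real (m n) powr \<epsilon>" for n
  have m2: "m n \<ge> 2" and s_pos: "s n > 0" for n by (simp_all add: m_def s_def)
  have ms: "real (m n) * s n = real (m n) powr (1 + \<epsilon>)" for n
    using m2[of n] by (simp add: s_def powr_add)
  have "\<forall>n. \<exists>D. finite D \<and> D \<subseteq> C \<and> card D = m n ^ d \<and> \<kappa> * s n \<le> log_sep D \<and>
           (\<forall>T\<in>D. \<tau> * (m n * s n) \<le> T_floor T \<and> ln (T_max T) \<le> K * (m n * s n))"
    using grid[OF m2 s_pos] by (simp add: d_def)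
  then obtain \<Delta> where fin: "\<And>n. finite (\<Delta> n)" and sub: "\<And>n. \<Delta> n \<subseteq> C"
    and card: "\<And>n. card (\<Delta> n) = m n ^ d" and sep: "\<And>n. \<kappa> * s n \<le> log_sep (\<Delta> n)"
    and floor: "\<And>n T. T \<in> \<Delta> n \<Longrightarrow> \<tau> * (m n * s n) \<le> T_floor T"
    and lnmax: "\<And>n T. T \<in> \<Delta> n \<Longrightarrow> ln (T_max T) \<le> K * (m n * s n)"
    by metis
  have card_pos: "card (\<Delta> n) > 0" for n using card m2[of n] by simp
  then have ne: "\<Delta> n \<noteq> {}" for n by (metis card.empty less_irrefl)
  have pos: "T $ i > 0" if "T \<in> C" for T i
    using that cone by (auto simp: polyhedral_cone_in_T_plus_def T_plus_def)
  have lncard: "ln (real (card (\<Delta> n))) = d * ln (m n)" for n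
    using m2[of n] by (simp add: card ln_realpow)
  have lncard_pos: "ln (real (card (\<Delta> n))) > 0" for n
    unfolding lncard using d m2[of n] by simp
  define r where "r n = real (card (\<Delta> n)) powr a * ln (real (card (\<Delta> n))) powr b" for n
  have r_pos: "r n > 0" for n
    unfolding r_def using card_pos[of n] lncard_pos[of n] by simp
  define X where "X n x = r n * Min ((\<lambda>T. f T x) ` \<Delta> n)" for n x
  \<comment> \<open>The normalization \<open>r n\<close> cancels in
    \<open>\<gamma> n * X n x\<close>, leaving the minimum times an upper bound, over the grid, for
    the \<open>a * \<delta>'\<close>-th power of \<open>ln (T_max T)\<close>.\<close>
  define \<gamma> where "\<gamma> n = (K * (m n * s n)) powr (a * \<delta>') / r n" for n
  have Kms: "K * (m n * s n) > 0" for n using K s_pos[of n] m2[of n] by (intro mult_pos_pos) auto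
  have X_meas: "random_variable borel (X n)" for n
  proof -
    have "(\<lambda>x. Min ((\<lambda>T. f T x) ` \<Delta> n)) \<in> borel_measurable M"
      using fin measurable sub by (intro borel_measurable_Min) auto
    then show ?thesis unfolding X_def by measurable
  qed
  have m_top: "filterlim (\<lambda>n. real (m n)) at_top sequentially"
    unfolding m_def by real_asymp
  have s_ratio: "filterlim (\<lambda>n. \<kappa> * s n / (d * ln (m n))) at_top sequentially"
  proof -
    have "filterlim (\<lambda>x::real. \<kappa> * x powr \<epsilon> / (d * ln x)) at_top at_top"
      using \<kappa> \<epsilon> d by real_asymp
    from filterlim_compose[OF this m_top] show ?thesis by (simp add: s_def)
  qed
  have ms_ratio: "filterlim (\<lambda>n. \<tau> * (m n * s n) / (d * ln (m n))) at_top sequentially"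
  proof -
    have "filterlim (\<lambda>x::real. \<tau> * x powr (1 + \<epsilon>) / (d * ln x)) at_top at_top"
      using \<tau> \<epsilon> d by real_asymp
    from filterlim_compose[OF this m_top] show ?thesis by (simp add: ms)
  qed
  have ms_top: "filterlim (\<lambda>n. \<tau> * (m n * s n)) at_top sequentially"
  proof -
    have "filterlim (\<lambda>x::real. \<tau> * x powr (1 + \<epsilon>)) at_top at_top"
      using \<tau> \<epsilon> by real_asymp
    from filterlim_compose[OF this m_top] show ?thesis by (simp add: ms)
  qed
  have "weak_conv_m (\<lambda>n. distr M borel (X n)) (weibull c a)"
    unfolding X_def r_def
  proof (rule conv)
    show "filterlim (\<lambda>n. card (\<Delta> n)) at_top sequentially"
    proof (rule filterlim_at_top_mono[OF filterlim_ident], intro always_eventually allI)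
      fix n
      have "m n ^ 1 \<le> m n ^ d" using d m2[of n] by (intro power_increasing) auto
      then show "n \<le> card (\<Delta> n)" by (simp add: card m_def)
    qed
    show "filterlim (\<lambda>n. log_sep (\<Delta> n) / ln (real (card (\<Delta> n)))) at_top sequentially"
      using sep lncard_pos
      by (intro filterlim_at_top_mono[OF s_ratio] always_eventually allI)
         (simp add: divide_right_mono less_imp_le flip: lncard)
    show "filterlim (\<lambda>n. Min (T_floor ` \<Delta> n) / ln (real (card (\<Delta> n)))) at_top sequentially"
    proof (intro filterlim_at_top_mono[OF ms_ratio] always_eventually allI)
      fix n
      have "\<tau> * (m n * s n) \<le> Min (T_floor ` \<Delta> n)"
        using fin ne floor by (subst Min_ge_iff) auto
      then show "\<tau> * (m n * s n) / (d * ln (m n)) \<le> Min (T_floor ` \<Delta> n) / ln (real (card (\<Delta> n)))"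
        unfolding lncard[symmetric] using lncard_pos[of n] by (intro divide_right_mono) auto
    qed
  qed (use fin sub in auto)
  moreover have "real_distribution (weibull c a)"
    using \<open>c > 0\<close> \<open>a > 0\<close> by (intro real_distribution_weibull)
  moreover have "\<gamma> \<longlonglongrightarrow> 0"
  proof -
    define \<rho> where "\<rho> = a * (d - (1 + \<epsilon>) * \<delta>')"
    have \<rho>: "\<rho> > 0" using gap \<open>a > 0\<close> by (simp add: \<rho>_def)
    have "((\<lambda>x::real. K powr (a * \<delta>') * x powr (- \<rho>)) \<longlongrightarrow> 0) at_top"
      using \<rho> by real_asymp
    from filterlim_compose[OF this m_top]
    have lim: "(\<lambda>n. K powr (a * \<delta>') * real (m n) powr (- \<rho>)) \<longlonglongrightarrow> 0" .
    have "filterlim (\<lambda>x::real. d * ln x) at_top at_top"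
      using d by real_asymp
    from filterlim_compose[OF this m_top]
    have ev: "\<forall>\<^sub>F n in sequentially. d * ln (m n) \<ge> 1"
      by (simp add: filterlim_at_top)
    have "\<forall>\<^sub>F n in sequentially. \<gamma> n \<le> K powr (a * \<delta>') * real (m n) powr (- \<rho>)"
      using ev
    proof eventually_elim
      case (elim n)
      have "1 \<le> ln (real (card (\<Delta> n))) powr b"
        unfolding lncard using elim \<open>b \<ge> 0\<close> by (intro ge_one_powr_ge_zero) auto
      then have "real (card (\<Delta> n)) powr a \<le> r n"
        unfolding r_def using mult_left_mono[of 1 _ "real (card (\<Delta> n)) powr a"] by simp
      moreover have "real (card (\<Delta> n)) powr a = real (m n) powr (d * a)"
        using m2[of n] by (simp add: card powr_powr flip: powr_realpow)
      ultimately have "real (m n) powr (d * a) \<le> r n" by simp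
      then have "\<gamma> n \<le> (K * (m n * s n)) powr (a * \<delta>') / real (m n) powr (d * a)"
        unfolding \<gamma>_def using m2[of n] r_pos[of n] by (intro divide_left_mono) auto
      also have "(K * (m n * s n)) powr (a * \<delta>') =
          K powr (a * \<delta>') * real (m n) powr ((1 + \<epsilon>) * (a * \<delta>'))"
        using K by (simp add: ms powr_mult powr_powr)
      also have "\<dots> / real (m n) powr (d * a) =
          K powr (a * \<delta>') * real (m n) powr ((1 + \<epsilon>) * (a * \<delta>') - d * a)"
        by (simp add: powr_diff)
      also have "(1 + \<epsilon>) * (a * \<delta>') - d * a = - \<rho>"
        by (simp add: \<rho>_def algebra_simps)
      finally show ?case .
    qed
    moreover have "\<forall>\<^sub>F n in sequentially. 0 \<le> \<gamma> n"
      using r_pos by (simp add: \<gamma>_def less_imp_le)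
    ultimately show ?thesis
      by (intro tendsto_sandwich[OF _ _ tendsto_const lim])
  qed
  moreover have "\<gamma> n > 0" for n
    unfolding \<gamma>_def using Kms[of n] r_pos[of n] by (metis divide_pos_pos powr_gt_zero less_irrefl)
  ultimately have freq: "AE x in M. \<exists>\<^sub>F n in sequentially. \<gamma> n * X n x \<le> \<eta>" if "\<eta> > 0" for \<eta>
    using that X_meas by (intro frequently_scaled_le_of_weak_conv[where \<mu> = "weibull c a"]) auto
  \<comment> \<open>Countably many thresholds allow a single null set for all of them.\<close>
  have "AE x in M. \<forall>j::nat. \<exists>\<^sub>F n in sequentially. \<gamma> n * X n x \<le> 1 / Suc j"
    unfolding AE_all_countable by (intro allI freq) simp
  with AE_space show "AE x in M. Liminf (T_max going_to at_top within C)
             (\<lambda>T. ereal (ln (T_max T) powr (a * \<delta>) * f T x)) = 0"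
  proof eventually_elim
    case (elim x)
    let ?F = "T_max going_to at_top within C"
    let ?g = "\<lambda>T. ln (T_max T) powr (a * \<delta>) * f T x"
    have "0 \<le> Liminf ?F (\<lambda>T. ereal (?g T))"
    proof (rule Liminf_bounded)
      have "0 \<le> ?g T" if "T \<in> C" for T
        using positive[OF that elim(1)] by simp
      then show "\<forall>\<^sub>F T in ?F. 0 \<le> ereal (?g T)"
        unfolding eventually_going_to_at_top_linorder by simp
    qed
    moreover have "\<not> 0 < Liminf ?F (\<lambda>T. ereal (?g T))"
    proof
      assume "0 < Liminf ?F (\<lambda>T. ereal (?g T))"
      then obtain y where y: "0 < ereal y" "ereal y < Liminf ?F (\<lambda>T. ereal (?g T))"
        using ereal_dense2 by blast
      from less_LiminfD[OF y(2)] obtain R where R: "\<And>T. T \<in> C \<Longrightarrow> R \<le> T_max T \<Longrightarrow> y < ?g T"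
        by (auto simp: eventually_going_to_at_top_linorder)
      obtain j where j: "1 / Suc j < y"
        using y(1) nat_approx_posE by (auto simp: zero_ereal_def)
      \<comment> \<open>The bound 1 permits raising the exponent from \<open>\<delta>\<close> to
        \<open>\<delta>'\<close>; the bound \<open>ln (max R 1)\<close>, whose argument is positive
        for any R, yields \<open>R \<le> T_max T\<close> after removing the logarithm.\<close>
      have "\<forall>\<^sub>F n in sequentially. \<tau> * (m n * s n) \<ge> max 1 (ln (max R 1))"
        using ms_top unfolding filterlim_at_top by blast
      with elim(2) have "\<exists>\<^sub>F n in sequentially.
          \<gamma> n * X n x \<le> 1 / Suc j \<and> \<tau> * (m n * s n) \<ge> max 1 (ln (max R 1))"
        by (intro frequently_eventually_frequently) auto
      then obtain n where n: "\<gamma> n * X n x \<le> 1 / Suc j" "\<tau> * (m n * s n) \<ge> max 1 (ln (max R 1))"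
        by (auto dest: frequently_ex)
      have "Min ((\<lambda>T. f T x) ` \<Delta> n) \<in> (\<lambda>T. f T x) ` \<Delta> n"
        using fin ne by (intro Min_in) auto
      \<comment> \<open>The minimizer over the grid, which depends on x and n, is the point
        contradicting the lower bound y.\<close>
      then obtain T where T: "T \<in> \<Delta> n" "Min ((\<lambda>T. f T x) ` \<Delta> n) = f T x" by auto
      have TC: "T \<in> C" using T(1) sub by auto
      have fpos: "f T x > 0" using positive TC elim(1) by auto
      have ln_ge: "max 1 (ln (max R 1)) \<le> ln (T_max T)"
        using n(2) floor[OF T(1)] T_floor_le_ln_T_max[of T, OF pos[OF TC]] by linarith
      have "T_max T > 0"
        using pos[OF TC] component_le_T_max[of T] by (meson less_le_trans)
      moreover have "ln (max R 1) \<le> ln (T_max T)" using ln_ge by simp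
      ultimately have "max R 1 \<le> T_max T" by (subst (asm) ln_le_cancel_iff) auto
      then have "y < ?g T" using R TC by simp
      also have "?g T \<le> (K * (m n * s n)) powr (a * \<delta>') * f T x"
      proof (intro mult_right_mono)
        have "ln (T_max T) powr (a * \<delta>) \<le> ln (T_max T) powr (a * \<delta>')"
          using ln_ge \<delta>' \<open>a > 0\<close> by (intro powr_mono) auto
        also have "\<dots> \<le> (K * (m n * s n)) powr (a * \<delta>')"
          using ln_ge \<delta>' \<open>a > 0\<close> lnmax[OF T(1)] by (intro powr_mono2) auto
        finally show "ln (T_max T) powr (a * \<delta>) \<le> (K * (m n * s n)) powr (a * \<delta>')" .
      qed (use fpos in simp)
      also have "\<dots> = \<gamma> n * X n x"
        using r_pos[of n] by (simp add: \<gamma>_def X_def T(2))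
      finally show False using n(1) j by simp
    qed
    ultimately show ?case by simp
  qed
qed

end
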